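(* Let $(A,\mu,\alpha,\beta)$ be a BiHom-associative algebra over a field $\Bbbk$ such that $\alpha$ and $\beta$ are bijective. For $a,a'\in A$ set $$[a,a']=aa'-\big(\alpha^{-1}\beta(a')\big)\big(\alpha\beta^{-1}(a)\big).$$ Then $(A,[-],\alpha,\beta)$ is a BiHom-Lie algebra (denoted $L(A)$).
   Context: All vector spaces are over a field $\Bbbk$, $\otimes=\otimes_\Bbbk$; multiplications $\mu:A\otimes A\to A$ are written $\mu(a\otimes a')=aa'$; algebras are not assumed unital. A BiHom-associative algebra is a 4-tuple $(A,\mu,\alpha,\beta)$ with $A$ a vector space and $\mu:A\otimes A\to A$, $\alpha,\beta:A\to A$ linear maps such that $\alpha\circ\beta=\beta\circ\alpha$, $\alpha(aa')=\alpha(a)\alpha(a')$, $\beta(aa')=\beta(a)\beta(a')$ and $\alpha(a)(a'a'')=(aa')\beta(a'')$ for all $a,a',a''\in A$. A BiHom-Lie algebra is a 4-tuple $(L,[-],\alpha,\beta)$ with $L$ a vector space, $\alpha,\beta:L\to L$ and $[-]:L\otimes L\to L$, $a\otimes a'\mapsto[a,a']$, linear maps such that for all $a,a',a''\in L$: $\alpha\circ\beta=\beta\circ\alpha$; $\alpha([a',a''])=[\alpha(a'),\alpha(a'')]$ and $\beta([a',a''])=[\beta(a'),\beta(a'')]$; $[\beta(a),\alpha(a')]=-[\beta(a'),\alpha(a)]$; and $[\beta^2(a),[\beta(a'),\alpha(a'')]]+[\beta^2(a'),[\beta(a''),\alpha(a)]]+[\beta^2(a''),[\beta(a),\alpha(a')]]=0$.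 *)

theory Defs
  imports Complex_Main
begin

text \<open>
  A vector space over a field is given by the locale \<^locale>\<open>vector_space\<close>: its elements are
  the elements of a type of class \<^class>\<open>ab_group_add\<close>. A linear map from the tensor square of
  \<open>A\<close> to \<open>A\<close> is represented, through the universal property of the tensor product, by the
  corresponding bilinear map in curried form.
\<close>

definition bilinear_op ::
  "('k::field \<Rightarrow> 'a::ab_group_add \<Rightarrow> 'a) \<Rightarrow> ('a \<Rightarrow> 'a \<Rightarrow> 'a) \<Rightarrow> bool"
  where "bilinear_op scale \<mu> \<longleftrightarrow>
    (\<forall>a. Vector_Spaces.linear scale scale (\<lambda>b. \<mu> a b)) \<and>
    (\<forall>b. Vector_Spaces.linear scale scale (\<lambda>a. \<mu> a b))"

locale bihom_associative_algebra = vector_space scale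
  for scale :: "'k::field \<Rightarrow> 'a::ab_group_add \<Rightarrow> 'a" +
  fixes \<mu> :: "'a \<Rightarrow> 'a \<Rightarrow> 'a" and \<alpha> \<beta> :: "'a \<Rightarrow> 'a"
  assumes bilinear_mult: "bilinear_op scale \<mu>"
    and linear_alpha: "Vector_Spaces.linear scale scale \<alpha>"
    and linear_beta: "Vector_Spaces.linear scale scale \<beta>"
    and alpha_beta_commute: "\<alpha> \<circ> \<beta> = \<beta> \<circ> \<alpha>"
    and alpha_mult: "\<alpha> (\<mu> a a') = \<mu> (\<alpha> a) (\<alpha> a')"
    and beta_mult: "\<beta> (\<mu> a a') = \<mu> (\<beta> a) (\<beta> a')"
    and bihom_assoc: "\<mu> (\<alpha> a) (\<mu> a' a'') = \<mu> (\<mu> a a') (\<beta> a'')"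

locale bihom_lie_algebra = vector_space scale
  for scale :: "'k::field \<Rightarrow> 'a::ab_group_add \<Rightarrow> 'a" +
  fixes bracket :: "'a \<Rightarrow> 'a \<Rightarrow> 'a" and \<alpha> \<beta> :: "'a \<Rightarrow> 'a"
  assumes bilinear_bracket: "bilinear_op scale bracket"
    and linear_alpha: "Vector_Spaces.linear scale scale \<alpha>"
    and linear_beta: "Vector_Spaces.linear scale scale \<beta>"
    and alpha_beta_commute: "\<alpha> \<circ> \<beta> = \<beta> \<circ> \<alpha>"
    and alpha_bracket: "\<alpha> (bracket a' a'') = bracket (\<alpha> a') (\<alpha> a'')"
    and beta_bracket: "\<beta> (bracket a' a'') = bracket (\<beta> a') (\<beta> a'')"
    and bihom_skew_symmetry: "bracket (\<beta> a) (\<alpha> a') = - bracket (\<beta> a') (\<alpha> a)"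
    and bihom_jacobi:
      "bracket (\<beta> (\<beta> a)) (bracket (\<beta> a') (\<alpha> a''))
       + bracket (\<beta> (\<beta> a')) (bracket (\<beta> a'') (\<alpha> a))
       + bracket (\<beta> (\<beta> a'')) (bracket (\<beta> a) (\<alpha> a')) = 0"

definition bihom_commutator ::
  "('a::ab_group_add \<Rightarrow> 'a \<Rightarrow> 'a) \<Rightarrow> ('a \<Rightarrow> 'a) \<Rightarrow> ('a \<Rightarrow> 'a) \<Rightarrow> 'a \<Rightarrow> 'a \<Rightarrow> 'a"
  where "bihom_commutator \<mu> \<alpha> \<beta> a a' = \<mu> a a' - \<mu> (inv \<alpha> (\<beta> a')) (\<alpha> (inv \<beta> a))"

end

theory Submission
  imports Defs
begin

text \<open>
  Write \<open>T a b c\<close> for \<open>\<beta>\<^sup>2(a)(\<beta>(b)\<alpha>(c))\<close>. On arguments of the form \<open>\<beta>(a), \<alpha>(a')\<close> the bracket is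
  \<open>\<beta>(a)\<alpha>(a') - \<beta>(a')\<alpha>(a)\<close>, which is visibly skew, and BiHom-associativity turns
  \<open>[\<beta>\<^sup>2(a), [\<beta>(b), \<alpha>(c)]]\<close> into \<open>T a b c - T a c b - T b c a + T c b a\<close>, whose cyclic sum cancels.
\<close>

lemma linear_inv_of_bij:
  assumes "Vector_Spaces.linear s s f" and "bij f"
  shows "Vector_Spaces.linear s s (inv f)"
proof -
  have f: "f (x + y) = f x + f y" "f (s r x) = s r (f x)" for x y r
    using assms(1) by (simp_all add: Vector_Spaces.linear_iff)
  have "inv f (x + y) = inv f x + inv f y" "inv f (s r x) = s r (inv f x)" for x y r
    using assms(2) by (simp_all add: inv_f_eq bij_is_inj f surj_f_inv_f bij_is_surj)
  then show ?thesis
    using assms(1) by (simp add: Vector_Spaces.linear_iff)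
qed

lemma bilinear_op_iff:
  "bilinear_op s m \<longleftrightarrow> vector_space s \<and>
    (\<forall>a b c. m a (b + c) = m a b + m a c) \<and> (\<forall>a b c. m (a + b) c = m a c + m b c) \<and>
    (\<forall>r a b. m a (s r b) = s r (m a b)) \<and> (\<forall>r a b. m (s r a) b = s r (m a b))"
  unfolding bilinear_op_def Vector_Spaces.linear_iff by blast

text \<open>The commutator has this shape with \<open>f\<close> = \<open>inv \<alpha>\<close> after
  \<open>\<beta>\<close> and \<open>g\<close> = \<open>\<alpha>\<close> after
  \<open>inv \<beta>\<close>; only the linearity of these two twists matters for
  bilinearity.\<close>

lemma bilinear_op_commutator:
  assumes "bilinear_op s m"
    and "Vector_Spaces.linear s s f" and "Vector_Spaces.linear s s g"
  shows "bilinear_op s (\<lambda>a b. m a b - m (f b) (g a))"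
proof -
  interpret vector_space s
    using assms(1) by (simp add: bilinear_op_iff)
  show ?thesis
    using assms by (simp add: bilinear_op_iff Vector_Spaces.linear_iff scale_right_diff_distrib)
qed

context bihom_associative_algebra
begin

lemma alpha_diff: "\<alpha> (a - b) = \<alpha> a - \<alpha> b"
proof -
  have "\<alpha> (a - b + b) = \<alpha> (a - b) + \<alpha> b"
    using linear_alpha unfolding Vector_Spaces.linear_iff by blast
  then show ?thesis by simp
qed

lemma beta_diff: "\<beta> (a - b) = \<beta> a - \<beta> b"
proof -
  have "\<beta> (a - b + b) = \<beta> (a - b) + \<beta> b"
    using linear_beta unfolding Vector_Spaces.linear_iff by blast
  then show ?thesis by simp
qed

lemma alpha_beta: "\<alpha> (\<beta> a) = \<beta> (\<alpha> a)"
  using alpha_beta_commute by (simp add: fun_eq_iff)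

context
  assumes bij_alpha: "bij \<alpha>" and bij_beta: "bij \<beta>"
begin

lemma inverses [simp]:
  "\<alpha> (inv \<alpha> a) = a" "inv \<alpha> (\<alpha> a) = a" "\<beta> (inv \<beta> a) = a" "inv \<beta> (\<beta> a) = a"
  using bij_alpha bij_beta by (simp_all add: bij_is_inj bij_is_surj surj_f_inv_f)

lemma beta_inv_alpha: "\<beta> (inv \<alpha> a) = inv \<alpha> (\<beta> a)"
  by (metis alpha_beta inverses(1,2))

lemma alpha_inv_beta: "\<alpha> (inv \<beta> a) = inv \<beta> (\<alpha> a)"
  by (metis alpha_beta inverses(3,4))

lemma bilinear_commutator: "bilinear_op scale (bihom_commutator \<mu> \<alpha> \<beta>)"
proof -
  have "Vector_Spaces.linear scale scale (\<lambda>a. inv \<alpha> (\<beta> a))"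
    "Vector_Spaces.linear scale scale (\<lambda>a. \<alpha> (inv \<beta> a))"
    using linear_inv_of_bij[OF linear_alpha bij_alpha] linear_inv_of_bij[OF linear_beta bij_beta]
      linear_alpha linear_beta
    by (simp_all add: Vector_Spaces.linear_iff)
  from bilinear_op_commutator[OF bilinear_mult this] show ?thesis
    by (simp add: bihom_commutator_def[abs_def])
qed

text \<open>In the swapped product \<open>\<alpha>\<close> cancels \<open>inv \<alpha>\<close> on
  one factor and commutes past \<open>inv \<beta>\<close> on the other;
  \<open>beta_commutator\<close> is the mirror image.\<close>

lemma alpha_commutator:
  "\<alpha> (bihom_commutator \<mu> \<alpha> \<beta> a b) = bihom_commutator \<mu> \<alpha> \<beta> (\<alpha> a) (\<alpha> b)"
  by (simp add: bihom_commutator_def alpha_diff alpha_mult alpha_inv_beta alpha_beta[symmetric])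

lemma beta_commutator:
  "\<beta> (bihom_commutator \<mu> \<alpha> \<beta> a b) = bihom_commutator \<mu> \<alpha> \<beta> (\<beta> a) (\<beta> b)"
  by (simp add: bihom_commutator_def beta_diff beta_mult beta_inv_alpha alpha_beta[symmetric])

text \<open>On such arguments both twists cancel: \<open>inv \<alpha> (\<beta> (\<alpha> b))\<close>
  is \<open>\<beta> b\<close>, and \<open>\<alpha> (inv \<beta> (\<beta> a))\<close> is
  \<open>\<alpha> a\<close>.\<close>

lemma commutator_beta_alpha:
  "bihom_commutator \<mu> \<alpha> \<beta> (\<beta> a) (\<alpha> b) = \<mu> (\<beta> a) (\<alpha> b) - \<mu> (\<beta> b) (\<alpha> a)"
  by (simp add: bihom_commutator_def alpha_beta[symmetric])

lemma commutator_beta_mult: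
  "bihom_commutator \<mu> \<alpha> \<beta> (\<beta> (\<beta> a)) (\<mu> (\<beta> b) (\<alpha> c))
    = \<mu> (\<beta> (\<beta> a)) (\<mu> (\<beta> b) (\<alpha> c)) - \<mu> (\<beta> (\<beta> b)) (\<mu> (\<beta> c) (\<alpha> a))"
proof -
  \<comment> \<open>Since \<open>\<alpha>\<close> is multiplicative, so is its inverse; on the
    second factor it cancels the \<open>\<alpha>\<close> applied to \<open>c\<close>.\<close>
  have "inv \<alpha> (\<beta> (\<mu> (\<beta> b) (\<alpha> c))) = \<mu> (inv \<alpha> (\<beta> (\<beta> b))) (\<beta> c)"
    by (metis alpha_beta alpha_mult beta_mult inverses(1,2))
  then have "bihom_commutator \<mu> \<alpha> \<beta> (\<beta> (\<beta> a)) (\<mu> (\<beta> b) (\<alpha> c))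
    = \<mu> (\<beta> (\<beta> a)) (\<mu> (\<beta> b) (\<alpha> c)) - \<mu> (\<mu> (inv \<alpha> (\<beta> (\<beta> b))) (\<beta> c)) (\<beta> (\<alpha> a))"
    by (simp add: bihom_commutator_def alpha_beta)
  then show ?thesis
    \<comment> \<open>Reassociating to the right applies \<open>\<alpha>\<close> to
      \<open>inv \<alpha> (\<beta> (\<beta> b))\<close>, which removes the inverse, and strips
      \<open>\<beta>\<close> from \<open>\<beta> (\<alpha> a)\<close>.\<close>
    by (simp add: bihom_assoc[symmetric])
qed

text \<open>Splits the outer bracket in the Jacobi sum, whose second argument is a difference of two
  products, so that \<open>commutator_beta_mult\<close> applies to each.\<close>

lemma commutator_diff:
  "bihom_commutator \<mu> \<alpha> \<beta> a (b - c)
    = bihom_commutator \<mu> \<alpha> \<beta> a b - bihom_commutator \<mu> \<alpha> \<beta> a c"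
proof -
  have "bihom_commutator \<mu> \<alpha> \<beta> a (b - c + c)
      = bihom_commutator \<mu> \<alpha> \<beta> a (b - c) + bihom_commutator \<mu> \<alpha> \<beta> a c"
    using bilinear_commutator unfolding bilinear_op_iff by blast
  then show ?thesis by simp
qed

lemma bihom_lie_algebra_commutator: "bihom_lie_algebra scale (bihom_commutator \<mu> \<alpha> \<beta>) \<alpha> \<beta>"
  \<comment> \<open>Skew symmetry and the Jacobi identity are left to the simplifier; in the latter
    each of the six permuted triple products occurs twice, with opposite signs.\<close>
  by (intro bihom_lie_algebra.intro bihom_lie_algebra_axioms.intro vector_space_axioms
      bilinear_commutator linear_alpha linear_beta alpha_beta_commute
      alpha_commutator beta_commutator)
    (simp_all add: commutator_beta_alpha commutator_diff commutator_beta_mult)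

end

end

theorem proposition3p15:
  fixes scale :: "'k::field \<Rightarrow> 'a::ab_group_add \<Rightarrow> 'a"
    and \<mu> :: "'a \<Rightarrow> 'a \<Rightarrow> 'a" and \<alpha> \<beta> :: "'a \<Rightarrow> 'a"
  assumes "bihom_associative_algebra scale \<mu> \<alpha> \<beta>"
    and "bij \<alpha>" and "bij \<beta>"
  shows "bihom_lie_algebra scale (bihom_commutator \<mu> \<alpha> \<beta>) \<alpha> \<beta>"
  using assms by (rule bihom_associative_algebra.bihom_lie_algebra_commutator)

end
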